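(* Let $N>\zeta\ge0$ and $M\ge1$ be integers, $\beta\in(0,1)$, and let $a_0,\dots,a_N$ be fixed real coefficients with $a_m\ge0$ for all $m$, $\sum_{m=\zeta}^{N-1}a_m>0$ and $\sum_{m=0}^Na_m=1$. With $\epsilon(k)$ and $\epsilon_{N,M}(k,l)$ as defined in the context, for all $k\in\{0,\dots,\zeta\}$ and $l\in\{0,\dots,M-1\}$, $$\epsilon(k)=\epsilon_{N,0}(k,0)=\epsilon_{N,M}(k,M)>\epsilon_{N,M}(k,l).$$
   Context: For integers $M\ge0$ and $0\le l\le M$ let $B_M(t;l)=\sum_{i=0}^l\binom{M}{i}t^i(1-t)^{M-i}$ (so $B_0(t;0)=1$). For $k\in\{0,\dots,\zeta\}$ and $l\in\{0,\dots,M\}$ let $$h_{N,M}(t;k,l)=\beta\sum_{m=k}^Na_m\binom{m}{k}t^{m-k}-\binom{N}{k}t^{N-k}B_M(1-t;l).$$ Under the stated conditions on $\beta$ and $(a_m)$ this polynomial has exactly one root in $(0,1)$, denoted $t_{N,M}(k,l)$, and $\epsilon_{N,M}(k,l)=1-t_{N,M}(k,l)$. The "wait-and-judge" bound $\epsilon(k)$ (which uses no validation samples) is $\epsilon(k)=1-t(k)$, where $t(k)$ is the unique root in $(0,1)$ of $$\beta\sum_{m=k}^Na_m\binom{m}{k}t^{m-k}-\binom{N}{k}t^{N-k}=0.$$ *)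

theory Defs
  imports "HOL-Analysis.Analysis"
begin

(* The distribution function at l of a binomial(M, t) random variable. *)
definition binom_cdf :: "nat \<Rightarrow> real \<Rightarrow> nat \<Rightarrow> real" where
  "binom_cdf M t l = (\<Sum>i=0..l. real (M choose i) * t ^ i * (1 - t) ^ (M - i))"

definition h_poly ::
  "real \<Rightarrow> (nat \<Rightarrow> real) \<Rightarrow> nat \<Rightarrow> nat \<Rightarrow> real \<Rightarrow> nat \<Rightarrow> nat \<Rightarrow> real" where
  "h_poly \<beta> a N M t k l =
     \<beta> * (\<Sum>m=k..N. a m * real (m choose k) * t ^ (m - k))
     - real (N choose k) * t ^ (N - k) * binom_cdf M (1 - t) l"

(* The definite description is meaningful only where the root is unique. *)
definition t_val :: "real \<Rightarrow> (nat \<Rightarrow> real) \<Rightarrow> nat \<Rightarrow> nat \<Rightarrow> nat \<Rightarrow> nat \<Rightarrow> real" where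
  "t_val \<beta> a N M k l = (THE t. 0 < t \<and> t < 1 \<and> h_poly \<beta> a N M t k l = 0)"

definition eps_val :: "real \<Rightarrow> (nat \<Rightarrow> real) \<Rightarrow> nat \<Rightarrow> nat \<Rightarrow> nat \<Rightarrow> nat \<Rightarrow> real" where
  "eps_val \<beta> a N M k l = 1 - t_val \<beta> a N M k l"

(* The bound without validation samples ("wait-and-judge"). *)
definition t_wj :: "real \<Rightarrow> (nat \<Rightarrow> real) \<Rightarrow> nat \<Rightarrow> nat \<Rightarrow> real" where
  "t_wj \<beta> a N k = (THE t. 0 < t \<and> t < 1 \<and>
     \<beta> * (\<Sum>m=k..N. a m * real (m choose k) * t ^ (m - k))
     - real (N choose k) * t ^ (N - k) = 0)"

definition eps_wj :: "real \<Rightarrow> (nat \<Rightarrow> real) \<Rightarrow> nat \<Rightarrow> nat \<Rightarrow> real" where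
  "eps_wj \<beta> a N k = 1 - t_wj \<beta> a N k"

end

theory Submission
  imports Defs
begin

text \<open>
  Dividing by \<open>t ^ (N - k)\<close> splits the polynomial into a strictly decreasing part, which is
  unbounded as \<open>t\<close> tends to 0, and minus a multiple of \<open>binom_cdf M (1 - t) l\<close>, which is
  increasing in \<open>t\<close>, bounded by 1, and equal to 1 at \<open>t = 1\<close>. Hence there is exactly one root.
  For \<open>l = M\<close> the distribution function is constantly 1, as without validation samples; for
  \<open>l < M\<close> it is smaller than 1 on the open interval, which moves the root to the right.
\<close>

lemma binom_cdf_0 [simp]: "binom_cdf M p 0 = (1 - p) ^ M"
  by (simp add: binom_cdf_def)

lemma binom_cdf_no_trials [simp]: "binom_cdf 0 p l = 1"
proof -
  have "(\<Sum>i=Suc 0..l. real (0 choose i) * p ^ i) = 0"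
    by (intro sum.neutral) (auto simp: binomial_eq_0)
  then show ?thesis by (simp add: binom_cdf_def sum.atLeast_Suc_atMost)
qed

lemma binom_cdf_full [simp]: "binom_cdf M p M = 1"
  using binomial_ring[of p "1 - p" M] by (simp add: binom_cdf_def atLeast0AtMost)

text \<open>Condition on one of the trials: a success leaves room for \<open>l\<close> further
  successes, a failure for \<open>Suc l\<close>.\<close>

lemma binom_cdf_Suc_Suc:
  "binom_cdf (Suc M) p (Suc l) = p * binom_cdf M p l + (1 - p) * binom_cdf M p (Suc l)"
proof -
  have shift: "(\<Sum>i=0..Suc l. f i) = f 0 + (\<Sum>i=0..l. f (Suc i))" for f :: "nat \<Rightarrow> real"
    by (rule sum.atLeast0_atMost_Suc_shift [unfolded comp_def])
  \<comment> \<open>For \<open>Suc i > M\<close> the exponents truncate, but then the binomial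
    coefficient is zero.\<close>
  have succ: "real (M choose Suc i) * p ^ Suc i * (1 - p) ^ (M - i)
      = (1 - p) * (real (M choose Suc i) * p ^ Suc i * (1 - p) ^ (M - Suc i))" for i
  proof (cases "Suc i \<le> M")
    case True
    then have "M - i = Suc (M - Suc i)" by simp
    then show ?thesis by simp
  next
    case False
    then show ?thesis by simp
  qed
  have pascal: "real (Suc M choose Suc i) * p ^ Suc i * (1 - p) ^ (Suc M - Suc i)
      = p * (real (M choose i) * p ^ i * (1 - p) ^ (M - i))
        + (1 - p) * (real (M choose Suc i) * p ^ Suc i * (1 - p) ^ (M - Suc i))" for i
    unfolding succ [symmetric] by (simp add: algebra_simps)
  show ?thesis
    unfolding binom_cdf_def shift pascal sum.distrib
    by (simp add: distrib_left sum_distrib_left)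
qed

lemma binom_cdf_mono:
  assumes "0 \<le> p" "p \<le> 1" "l \<le> l'"
  shows "binom_cdf M p l \<le> binom_cdf M p l'"
  unfolding binom_cdf_def by (rule sum_mono2) (use assms in auto)

text \<open>The recursion allows an induction on \<open>M\<close> without derivatives: raising the
  success probability moves weight from the larger value to the smaller one.\<close>

lemma binom_cdf_antimono:
  assumes "0 \<le> p" "p \<le> q" "q \<le> 1"
  shows "binom_cdf M q l \<le> binom_cdf M p l"
proof (induction M arbitrary: l)
  case 0
  show ?case by simp
next
  case (Suc M)
  show ?case
  proof (cases l)
    case 0
    have "(1 - q) ^ Suc M \<le> (1 - p) ^ Suc M"
      using assms by (intro power_mono) auto
    then show ?thesis using 0 by simp
  next
    case (Suc n)
    have "binom_cdf (Suc M) q l \<le> q * binom_cdf M p n + (1 - q) * binom_cdf M p (Suc n)"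
      unfolding Suc binom_cdf_Suc_Suc
      using assms Suc.IH by (intro add_mono mult_left_mono) auto
    also have "\<dots> = binom_cdf M p (Suc n) - q * (binom_cdf M p (Suc n) - binom_cdf M p n)"
      by (simp add: algebra_simps)
    also have "\<dots> \<le> binom_cdf M p (Suc n) - p * (binom_cdf M p (Suc n) - binom_cdf M p n)"
      using assms binom_cdf_mono[of p n "Suc n" M] by (intro diff_left_mono mult_right_mono) auto
    also have "\<dots> = binom_cdf (Suc M) p l"
      unfolding Suc binom_cdf_Suc_Suc by (simp add: algebra_simps)
    finally show ?thesis .
  qed
qed

text \<open>The sum up to \<open>l\<close> omits at least the term \<open>p ^ M\<close> for
  \<open>i = M\<close>, which is positive.\<close>

lemma binom_cdf_less_1:
  assumes "0 < p" "p \<le> 1" "l < M"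
  shows "binom_cdf M p l < 1"
proof -
  have "binom_cdf M p l < binom_cdf M p M"
    unfolding binom_cdf_def
  proof (rule sum_strict_mono2 [where b = M])
    show "0 < real (M choose M) * p ^ M * (1 - p) ^ (M - M)"
      using assms by simp
  qed (use assms in auto)
  then show ?thesis by simp
qed

lemma binom_cdf_le_1:
  assumes "0 \<le> p" "p \<le> 1" "l \<le> M"
  shows "binom_cdf M p l \<le> 1"
  using binom_cdf_mono[OF assms, of M] by simp

text \<open>The index \<open>r < N\<close> supplies a positive coefficient: it makes the
  monotonicity strict and makes the first sum dominate near 0.\<close>

context
  fixes N k r :: nat and \<beta> :: real and a :: "nat \<Rightarrow> real"
  assumes \<beta>: "0 < \<beta>" "\<beta> < 1"
    and nonneg: "\<And>m. m \<le> N \<Longrightarrow> 0 \<le> a m"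
    and r: "k \<le> r" "r < N" "0 < a r"
    and total: "(\<Sum>m=k..N. a m) \<le> 1"
begin

text \<open>Strict monotonicity of \<open>h_poly \<beta> a N M t k l / t ^ (N - k)\<close>, with denominators cleared.\<close>

lemma h_poly_ratio_less:
  assumes "0 < s" "s < t" "t \<le> 1"
  shows "h_poly \<beta> a N M t k l * s ^ (N - k) < h_poly \<beta> a N M s k l * t ^ (N - k)"
proof -
  let ?c = "\<lambda>m. a m * real (m choose k)"
  \<comment> \<open>Isolates a factor symmetric in \<open>u\<close> and \<open>v\<close>, so that
    exchanging them changes only the base of the power \<open>N - m\<close>.\<close>
  have swap: "u ^ (m - k) * v ^ (N - k) = (u * v) ^ (m - k) * v ^ (N - m)"
    if "k \<le> m" "m \<le> N" for u v :: real and m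
  proof -
    have "N - k = (m - k) + (N - m)" using that by simp
    then show ?thesis by (simp add: power_add power_mult_distrib)
  qed
  have "(\<Sum>m=k..N. ?c m * t ^ (m - k)) * s ^ (N - k)
      = (\<Sum>m=k..N. ?c m * ((t * s) ^ (m - k) * s ^ (N - m)))"
    unfolding sum_distrib_right by (intro sum.cong) (auto simp: swap mult.assoc)
  also have "\<dots> < (\<Sum>m=k..N. ?c m * ((t * s) ^ (m - k) * t ^ (N - m)))"
  proof (rule sum_strict_mono_ex1)
    show "\<forall>m\<in>{k..N}. ?c m * ((t * s) ^ (m - k) * s ^ (N - m))
        \<le> ?c m * ((t * s) ^ (m - k) * t ^ (N - m))"
      using assms nonneg by (auto intro!: mult_left_mono power_mono)
    have "s ^ (N - r) < t ^ (N - r)"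
      using assms r by (intro power_strict_mono) auto
    then show "\<exists>m\<in>{k..N}. ?c m * ((t * s) ^ (m - k) * s ^ (N - m))
        < ?c m * ((t * s) ^ (m - k) * t ^ (N - m))"
      using assms r by (intro bexI[of _ r]) auto
  qed simp
  also have "\<dots> = (\<Sum>m=k..N. ?c m * s ^ (m - k)) * t ^ (N - k)"
    unfolding sum_distrib_right by (intro sum.cong) (auto simp: swap mult.assoc mult.commute[of t s])
  finally have main: "\<beta> * ((\<Sum>m=k..N. ?c m * t ^ (m - k)) * s ^ (N - k))
      < \<beta> * ((\<Sum>m=k..N. ?c m * s ^ (m - k)) * t ^ (N - k))"
    using \<beta> by simp
  have "real (N choose k) * (s * t) ^ (N - k) * binom_cdf M (1 - s) l
      \<le> real (N choose k) * (s * t) ^ (N - k) * binom_cdf M (1 - t) l"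
    using assms by (intro mult_left_mono binom_cdf_antimono) auto
  with main show ?thesis
    unfolding h_poly_def by (simp add: algebra_simps power_mult_distrib)
qed

text \<open>Since \<open>m choose k\<close> is at most \<open>N choose k\<close> and the
  coefficients sum to at most 1, the value is at most
  \<open>(\<beta> - 1) * (N choose k)\<close>.\<close>

lemma h_poly_1_neg: "h_poly \<beta> a N M 1 k l < 0"
proof -
  have "(\<Sum>m=k..N. a m * real (m choose k)) \<le> (\<Sum>m=k..N. a m * real (N choose k))"
    using nonneg by (intro sum_mono mult_left_mono) (auto intro: binomial_right_mono)
  also have "\<dots> = (\<Sum>m=k..N. a m) * real (N choose k)"
    by (simp add: sum_distrib_right)
  also have "\<dots> \<le> 1 * real (N choose k)"
    using total by (intro mult_right_mono) auto
  finally have "\<beta> * (\<Sum>m=k..N. a m * real (m choose k)) \<le> \<beta> * real (N choose k)"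
    using \<beta> by simp
  also have "\<dots> < 1 * real (N choose k)"
    using \<beta> r by (intro mult_strict_right_mono) auto
  finally have "\<beta> * (\<Sum>m=k..N. a m * real (m choose k)) < real (N choose k)" by simp
  moreover have "binom_cdf M 0 l = 1"
    by (simp add: binom_cdf_def sum.atLeast_Suc_atMost)
  ultimately show ?thesis by (simp add: h_poly_def)
qed

lemma h_poly_pos_near_0:
  assumes "l \<le> M"
  shows "\<exists>t. 0 < t \<and> t < 1 \<and> 0 < h_poly \<beta> a N M t k l"
proof -
  define c where "c = \<beta> * (a r * real (r choose k))"
  define C where "C = real (N choose k)"
  have c: "0 < c" using \<beta> r by (simp add: c_def)
  have C: "0 < C" using r by (simp add: C_def)
  \<comment> \<open>The second bound gives \<open>C * t \<le> c / 2 < c\<close>; the first keeps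
    \<open>t\<close> below 1.\<close>
  define t where "t = min (1/2) (c / (2 * C))"
  have t: "0 < t" "t < 1" using c C by (auto simp: t_def)
  have "t * (2 * C) \<le> c"
    using C by (simp add: t_def pos_le_divide_eq [symmetric])
  then have Ct: "C * t < c" using c by (simp add: algebra_simps)
  have "a r * real (r choose k) * t ^ (r - k) \<le> (\<Sum>m=k..N. a m * real (m choose k) * t ^ (m - k))"
    using r nonneg t by (intro member_le_sum) auto
  then have 1: "c * t ^ (r - k) \<le> \<beta> * (\<Sum>m=k..N. a m * real (m choose k) * t ^ (m - k))"
    using \<beta> by (simp add: c_def mult.assoc)
  have "C * t ^ (N - k) * binom_cdf M (1 - t) l \<le> C * t ^ (N - k) * 1"
    using t C assms by (intro mult_left_mono binom_cdf_le_1) auto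
  \<comment> \<open>As \<open>r < N\<close>, the subtracted term carries at least one more factor
    \<open>t\<close> than the summand at \<open>r\<close>.\<close>
  also have "\<dots> \<le> C * t ^ Suc (r - k)"
    using t C r power_decreasing[of "Suc (r - k)" "N - k" t] by (simp add: Suc_diff_le)
  also have "\<dots> < c * t ^ (r - k)"
    using Ct t by (simp add: mult.assoc [symmetric])
  finally show ?thesis using 1 t by (auto simp: h_poly_def C_def)
qed

lemma h_poly_root_unique:
  assumes "l \<le> M"
  shows "\<exists>!t. 0 < t \<and> t < 1 \<and> h_poly \<beta> a N M t k l = 0"
proof -
  obtain t0 where t0: "0 < t0" "t0 < 1" "0 < h_poly \<beta> a N M t0 k l"
    using h_poly_pos_near_0[OF assms] by blast
  have "continuous_on {t0..1} (\<lambda>t. h_poly \<beta> a N M t k l)"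
    unfolding h_poly_def binom_cdf_def by (intro continuous_intros)
  then obtain t where t: "t0 \<le> t" "t \<le> 1" "h_poly \<beta> a N M t k l = 0"
    using IVT2'[of "\<lambda>t. h_poly \<beta> a N M t k l" 1 0 t0] t0 h_poly_1_neg[of M l] by auto
  have "t \<noteq> 1" using t h_poly_1_neg[of M l] by auto
  show ?thesis
  proof (intro ex1I[of _ t] conjI)
    fix s assume "0 < s \<and> s < 1 \<and> h_poly \<beta> a N M s k l = 0"
    \<comment> \<open>Two distinct roots would turn the strict ratio inequality into
      \<open>0 < 0\<close>.\<close>
    then show "s = t"
      using h_poly_ratio_less[of s t M l] h_poly_ratio_less[of t s M l] t t0
      by (cases s t rule: linorder_cases) auto
  qed (use t t0 \<open>t \<noteq> 1\<close> in auto)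
qed

lemma t_val_root:
  assumes "l \<le> M"
  shows "0 < t_val \<beta> a N M k l" "t_val \<beta> a N M k l < 1"
    "h_poly \<beta> a N M (t_val \<beta> a N M k l) k l = 0"
  using theI'[OF h_poly_root_unique[OF assms]] unfolding t_val_def by auto

lemma t_val_full_less:
  assumes "l < M"
  shows "t_val \<beta> a N M k M < t_val \<beta> a N M k l"
proof (rule ccontr)
  define t where "t = t_val \<beta> a N M k M"
  define s where "s = t_val \<beta> a N M k l"
  have t: "0 < t" "t < 1" "h_poly \<beta> a N M t k M = 0"
    unfolding t_def using t_val_root[of M M] by auto
  have s: "0 < s" "s < 1" "h_poly \<beta> a N M s k l = 0"
    unfolding s_def using t_val_root[of l M] assms by auto
  have "real (N choose k) * t ^ (N - k) * binom_cdf M (1 - t) l < real (N choose k) * t ^ (N - k) * 1"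
    using t r assms by (intro mult_strict_left_mono binom_cdf_less_1) auto
  with t have pos: "0 < h_poly \<beta> a N M t k l" by (simp add: h_poly_def)
  assume "\<not> t_val \<beta> a N M k M < t_val \<beta> a N M k l"
  then consider "s < t" | "s = t" unfolding s_def t_def by linarith
  then show False
  proof cases
    case 1
    \<comment> \<open>The ratio vanishes at \<open>s\<close>, hence would be negative at the later
      point \<open>t\<close>, against \<open>pos\<close>.\<close>
    then have "h_poly \<beta> a N M t k l * s ^ (N - k) < 0"
      using h_poly_ratio_less[of s t M l] s t by simp
    then show False using pos s by (simp add: mult_less_0_iff)
  next
    case 2
    then show False using pos s by simp
  qed
qed

end

theorem corollary3:
  fixes N M \<zeta> :: nat and \<beta> :: real and a :: "nat \<Rightarrow> real"
  assumes "N > \<zeta>" and "M \<ge> 1"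
    and "0 < \<beta>" and "\<beta> < 1"
    and "\<forall>m\<in>{0..N}. a m \<ge> 0"
    and "(\<Sum>m=\<zeta>..N-1. a m) > 0"
    and "(\<Sum>m=0..N. a m) = 1"
  shows "\<forall>k\<in>{0..\<zeta>}. \<forall>l\<in>{0..M-1}.
           eps_wj \<beta> a N k = eps_val \<beta> a N 0 k 0 \<and>
           eps_val \<beta> a N 0 k 0 = eps_val \<beta> a N M k M \<and>
           eps_val \<beta> a N M k M > eps_val \<beta> a N M k l"
proof (intro ballI)
  fix k l assume kl: "k \<in> {0..\<zeta>}" "l \<in> {0..M-1}"
  obtain r where r: "r \<in> {\<zeta>..N-1}" "0 < a r"
    using assms(6) sum_nonpos[of "{\<zeta>..N-1}" a] by (metis not_le)
  have "(\<Sum>m=k..N. a m) \<le> (\<Sum>m=0..N. a m)"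
    using assms(5) by (intro sum_mono2) auto
  then have "t_val \<beta> a N M k M < t_val \<beta> a N M k l"
    using assms kl r by (intro t_val_full_less[where r = r]) auto
  then show "eps_wj \<beta> a N k = eps_val \<beta> a N 0 k 0 \<and>
      eps_val \<beta> a N 0 k 0 = eps_val \<beta> a N M k M \<and>
      eps_val \<beta> a N M k M > eps_val \<beta> a N M k l"
    \<comment> \<open>With \<open>binom_cdf\<close> equal to 1 in both cases, the three root
      descriptions coincide; passing to \<open>1 - t\<close> reverses the strict inequality.\<close>
    by (simp add: eps_wj_def eps_val_def t_wj_def t_val_def h_poly_def)
qed

end
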